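(* For every $\varepsilon>0$, $$c_L(Q_n)=\Omega\left(\frac{2^n}{n^{7/2+\varepsilon}}\right)$$ as $n\to\infty$, where $Q_n$ is the $n$-dimensional hypercube graph and the implied constant may depend on $\varepsilon$.
   Context: Lazy Cops and Robbers is a game played on a finite undirected graph $G$ by a set of cops and a single robber, all with full information. First the cops choose their starting vertices (several cops may share a vertex), then the robber chooses his starting vertex. Thereafter the sides alternate, cops first: on the cops' turn at most one cop moves to an adjacent vertex (the others stay put); on the robber's turn the robber moves to an adjacent vertex or stays put. The cops win if after finitely many rounds some cop occupies the same vertex as the robber; the robber wins if he can evade capture indefinitely. The lazy cop number $c_L(G)$ is the minimum number of cops that have a winning strategy on $G$. The hypercube $Q_n$ has vertex set $\{0,1\}^n$, two vertices being adjacent exactly when they differ in exactly one coordinate. *)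

theory Defs
  imports
    "HOL-Library.Landau_Symbols"
    "Graph_Theory.Pair_Digraph"
    Complex_Main
begin

text \<open>
  Undirected graphs are symmetric loop-free digraphs, as in \<^locale>\<open>pair_graph\<close>.
  The vertices \<open>{0,1}\<^sup>n\<close> of the hypercube are the Boolean lists of length \<open>n\<close>.
\<close>

definition hypercube :: "nat \<Rightarrow> bool list pair_pre_digraph" where
  "hypercube n =
    \<lparr> pverts = {x. length x = n},
      parcs = {(x, y). length x = n \<and> length y = n \<and> card {i. i < n \<and> x ! i \<noteq> y ! i} = 1} \<rparr>"

lemma pair_graph_hypercube: "pair_graph (hypercube n)"
proof -
  have fin: "finite {x :: bool list. length x = n}"
    using finite_lists_length_eq[of "UNIV :: bool set" n] by simp
  have finE: "finite (parcs (hypercube n))"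
    by (rule finite_subset[OF _ finite_cartesian_product[OF fin fin]])
      (auto simp: hypercube_def)
  have sym: "sym (parcs (hypercube n))"
  proof (rule symI)
    fix x y assume xy: "(x, y) \<in> parcs (hypercube n)"
    have "{i. i < n \<and> y ! i \<noteq> x ! i} = {i. i < n \<and> x ! i \<noteq> y ! i}"
      by (rule Collect_cong) metis
    with xy show "(y, x) \<in> parcs (hypercube n)"
      unfolding hypercube_def by simp
  qed
  have verts: "x \<in> pverts (hypercube n)" "y \<in> pverts (hypercube n)" "x \<noteq> y"
    if "(x, y) \<in> parcs (hypercube n)" for x y
    using that unfolding hypercube_def by auto
  show ?thesis
  proof unfold_locales
    show "finite (pverts (hypercube n))" using fin unfolding hypercube_def by simp
    show "symmetric (with_proj (hypercube n))"
      unfolding symmetric_def with_proj_simps by (rule sym)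
  qed (use finE in \<open>auto dest: verts\<close>)
qed


text \<open>
  A cop position is the list of the vertices of the \<open>k\<close> cops; repeated vertices are allowed.
\<close>

definition lazy_cop_move :: "'a pair_pre_digraph \<Rightarrow> 'a list \<Rightarrow> 'a list \<Rightarrow> bool" where
  "lazy_cop_move G p q \<longleftrightarrow>
    q = p \<or> (\<exists>i v. i < length p \<and> (p ! i, v) \<in> parcs G \<and> q = p[i := v])"

text \<open>\<open>r t\<close> is the vertex of the robber after \<open>t\<close> of his moves; \<open>r 0\<close> is his starting vertex.\<close>

definition robber_walk :: "'a pair_pre_digraph \<Rightarrow> (nat \<Rightarrow> 'a) \<Rightarrow> bool" where
  "robber_walk G r \<longleftrightarrow>
    r 0 \<in> pverts G \<and> (\<forall>t. r (Suc t) = r t \<or> (r t, r (Suc t)) \<in> parcs G)"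

text \<open>
  A cop strategy \<open>S\<close> maps the list of the robber's vertices so far to the next cop position:
  \<open>S []\<close> is the initial position, chosen before the robber's, and \<open>S [r 0, \<dots>, r t]\<close> is the
  position after the cops' reply to \<open>r t\<close>. Since \<open>S\<close> is deterministic, the robber's vertices
  determine the whole history of the game. The game is formally continued after a capture;
  this is harmless, since both sides may stay put.
\<close>

definition lazy_cop_strategy ::
    "'a pair_pre_digraph \<Rightarrow> nat \<Rightarrow> ('a list \<Rightarrow> 'a list) \<Rightarrow> bool" where
  "lazy_cop_strategy G k S \<longleftrightarrow>
    length (S []) = k \<and> set (S []) \<subseteq> pverts G \<and>
    (\<forall>r. robber_walk G r \<longrightarrow>
      (\<forall>t. lazy_cop_move G (S (map r [0..<t])) (S (map r [0..<Suc t]))))"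

text \<open>
  The two disjuncts are capture on the robber's own placement or move, and capture by the
  cops' reply.
\<close>

definition winning_lazy_cop_strategy ::
    "'a pair_pre_digraph \<Rightarrow> nat \<Rightarrow> ('a list \<Rightarrow> 'a list) \<Rightarrow> bool" where
  "winning_lazy_cop_strategy G k S \<longleftrightarrow>
    lazy_cop_strategy G k S \<and>
    (\<forall>r. robber_walk G r \<longrightarrow>
      (\<exists>t. r t \<in> set (S (map r [0..<t])) \<or> r t \<in> set (S (map r [0..<Suc t]))))"

definition lazy_cop_number :: "'a pair_pre_digraph \<Rightarrow> nat" where
  "lazy_cop_number G = (LEAST k. \<exists>S. winning_lazy_cop_strategy G k S)"

lemma lazy_cop_number_attained:
  assumes "finite (pverts G)"
  shows "\<exists>S. winning_lazy_cop_strategy G (lazy_cop_number G) S"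
proof -
  obtain vs where vs: "set vs = pverts G"
    using finite_list[OF assms] by blast
  have "winning_lazy_cop_strategy G (length vs) (\<lambda>_. vs)"
    unfolding winning_lazy_cop_strategy_def lazy_cop_strategy_def lazy_cop_move_def
    by (auto simp: vs robber_walk_def)
  then have "\<exists>k S. winning_lazy_cop_strategy G k S" by blast
  then show ?thesis unfolding lazy_cop_number_def by (rule LeastI_ex)
qed

end

theory Submission
  imports Defs
begin

text \<open>
  Give a cop at distance \<open>d\<close> from the robber the potential \<open>f d\<close>, with \<open>f 0 = f 1 = 1\<close>. As long as
  the total potential after the robber's move is below 1, all cops are at distance at least 2, so
  none can capture him. If \<open>f\<close> is chosen so that its average over the neighbours of the robber is
  at most \<open>(1 - \<delta> / n) f d\<close> for \<open>d \<ge> 2\<close>, up to a small error, then some neighbour has a total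
  potential smaller by the factor \<open>1 - \<delta> / n\<close>; this compensates the increase caused by the single
  cop that moves, which is about \<open>3 / n\<close> (attained when it comes from distance 2 to distance 1).
  Such an \<open>f\<close> exists with \<open>\<delta> = 7/2\<close> and with values of order \<open>n\<^sup>3 / 2\<^sup>n\<close> at the middle levels,
  and \<open>c 2\<^sup>n / n\<^bsup>7/2\<^esup>\<close> cops cannot overcome the error for a small constant \<open>c > 0\<close>.
\<close>

section \<open>Evading lazy cops with a potential function\<close>

text \<open>Reduces the infinite game to an invariant of single positions, taken with the cops to
  move. As \<open>S\<close> is deterministic, one robber walk built against it by recursion refutes
  it.\<close>

lemma not_winning_lazy_cop_strategy_if_safe:
  fixes safe :: "'a list \<Rightarrow> 'a \<Rightarrow> bool"
  assumes wf: "\<And>u v. (u, v) \<in> parcs G \<Longrightarrow> v \<in> pverts G"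
    and start: "\<And>p. length p = k \<Longrightarrow> set p \<subseteq> pverts G \<Longrightarrow> \<exists>v\<in>pverts G. safe p v"
    and avoid: "\<And>p v. safe p v \<Longrightarrow> v \<notin> set p"
    and step: "\<And>p q v. length p = k \<Longrightarrow> set p \<subseteq> pverts G \<Longrightarrow> set q \<subseteq> pverts G \<Longrightarrow>
      v \<in> pverts G \<Longrightarrow> safe p v \<Longrightarrow> lazy_cop_move G p q \<Longrightarrow>
      v \<notin> set q \<and> (\<exists>v'. (v, v') \<in> parcs G \<and> safe q v')"
  shows "\<not> winning_lazy_cop_strategy G k S"
proof
  assume win: "winning_lazy_cop_strategy G k S"
  then have strat: "lazy_cop_strategy G k S"
    unfolding winning_lazy_cop_strategy_def by blast
  have S0: "length (S []) = k" "set (S []) \<subseteq> pverts G"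
    using strat unfolding lazy_cop_strategy_def by auto
  obtain v0 where v0: "v0 \<in> pverts G" "safe (S []) v0"
    using start[OF S0] by blast
  \<comment> \<open>Staying put as the default makes \<open>r\<close> a legal walk before any safety
    is known; the moves of \<open>S\<close> are only guaranteed to be legal along such
    walks.\<close>
  define nxt where "nxt q v =
    (if \<exists>v'. (v, v') \<in> parcs G \<and> safe q v' then SOME v'. (v, v') \<in> parcs G \<and> safe q v' else v)" for q v
  have nxt_arc: "nxt q v = v \<or> (v, nxt q v) \<in> parcs G" for q v
    unfolding nxt_def by (auto intro: someI2)
  have nxt_safe: "safe q (nxt q v)" if "\<exists>v'. (v, v') \<in> parcs G \<and> safe q v'" for q v
    using someI_ex[OF that] that unfolding nxt_def by auto
  \<comment> \<open>The recursion carries the whole list of robber vertices, because that list is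
    the argument of \<open>S\<close>.\<close>
  define H where "H = rec_nat [v0] (\<lambda>_ h. h @ [nxt (S h) (last h)])"
  have H_simps: "H 0 = [v0]" "H (Suc t) = H t @ [nxt (S (H t)) (last (H t))]" for t
    by (simp_all add: H_def)
  define r where "r t = last (H t)" for t
  have r_simps: "r 0 = v0" "r (Suc t) = nxt (S (H t)) (r t)" for t
    by (simp_all add: r_def H_simps)
  have hist: "map r [0..<Suc t] = H t" for t
  proof (induction t)
    case (Suc t)
    have "map r [0..<Suc (Suc t)] = map r [0..<Suc t] @ [r (Suc t)]" by simp
    with Suc show ?case by (simp only: H_simps r_simps) (simp add: r_def)
  qed (simp add: H_simps r_simps)
  have walk: "robber_walk G r"
    unfolding robber_walk_def using v0 nxt_arc by (auto simp: r_simps)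
  have move: "lazy_cop_move G (S (map r [0..<t])) (S (map r [0..<Suc t]))" for t
    using strat walk unfolding lazy_cop_strategy_def by blast
  have r_vert: "r t \<in> pverts G" for t
    by (induction t) (use walk wf in \<open>auto simp: robber_walk_def, metis\<close>)
  have pos: "length (S (map r [0..<t])) = k \<and> set (S (map r [0..<t])) \<subseteq> pverts G" for t
  proof (induction t)
    case (Suc t)
    with move[of t] wf show ?case
      unfolding lazy_cop_move_def by (auto dest!: subsetD[OF set_update_subset_insert])
  qed (simp add: S0)
  have safe: "safe (S (map r [0..<t])) (r t)" for t
  proof (induction t)
    case (Suc t)
    have "\<exists>v'. (r t, v') \<in> parcs G \<and> safe (S (map r [0..<Suc t])) v'"
      using step[OF _ _ _ r_vert Suc move] pos[of t] pos[of "Suc t"] by blast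
    then show ?case
      using nxt_safe unfolding r_simps(2) hist by blast
  qed (simp add: v0 r_simps)
  have "r t \<notin> set (S (map r [0..<t]))" "r t \<notin> set (S (map r [0..<Suc t]))" for t
    using avoid[OF safe] step[OF _ _ _ r_vert safe move] pos[of t] pos[of "Suc t"] by blast+
  then show False
    using win walk unfolding winning_lazy_cop_strategy_def by blast
qed

section \<open>Hamming distance, and sums over neighbours and over all vertices of the
  hypercube\<close>

definition hdist :: "'a list \<Rightarrow> 'a list \<Rightarrow> nat" where
  "hdist x y = card {i. i < length x \<and> x ! i \<noteq> y ! i}"

definition flip_at :: "nat \<Rightarrow> bool list \<Rightarrow> bool list" where
  "flip_at i x = x[i := \<not> x ! i]"

lemma length_flip_at [simp]: "length (flip_at i x) = length x"
  by (simp add: flip_at_def)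

lemma hdist_le: "hdist x y \<le> length x"
  unfolding hdist_def using card_mono[of "{..<length x}" "{i. i < length x \<and> x ! i \<noteq> y ! i}"] by auto

lemma hdist_eq_0_iff: "length x = length y \<Longrightarrow> hdist x y = 0 \<longleftrightarrow> x = y"
  unfolding hdist_def by (auto simp: list_eq_iff_nth_eq)

lemma hdist_self [simp]: "hdist x x = 0"
  by (simp add: hdist_eq_0_iff)

lemma hdist_flip_at:
  assumes "length x = length y" "i < length y"
  shows "hdist x (flip_at i y) = (if x ! i = y ! i then hdist x y + 1 else hdist x y - 1)"
proof (cases "x ! i = y ! i")
  case True
  have "{j. j < length x \<and> x ! j \<noteq> flip_at i y ! j} = insert i {j. j < length x \<and> x ! j \<noteq> y ! j}"
    using assms True by (auto simp: flip_at_def nth_list_update)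
  then show ?thesis using True by (simp add: hdist_def)
next
  case False
  have "{j. j < length x \<and> x ! j \<noteq> flip_at i y ! j} = {j. j < length x \<and> x ! j \<noteq> y ! j} - {i}"
    using assms False by (auto simp: flip_at_def nth_list_update)
  then show ?thesis using False assms by (simp add: hdist_def)
qed

lemma arc_hypercube_iff:
  "(x, y) \<in> parcs (hypercube n) \<longleftrightarrow> length x = n \<and> length y = n \<and> hdist x y = 1"
  by (auto simp: hypercube_def hdist_def)

lemma arc_flip_at:
  assumes "length x = n" "i < n"
  shows "(x, flip_at i x) \<in> parcs (hypercube n)"
  using assms hdist_flip_at[of x x i] by (simp add: arc_hypercube_iff hdist_eq_0_iff)

text \<open>Flipping a differing coordinate brings \<open>y\<close> closer to \<open>x\<close>, any
  other flip takes it away. At distance 0 the truncated \<open>hdist x y - 1\<close> has coefficient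
  0.\<close>

lemma sum_flip_at:
  fixes f :: "nat \<Rightarrow> real"
  assumes "length x = n" "length y = n"
  shows "(\<Sum>i<n. f (hdist x (flip_at i y))) =
    real (hdist x y) * f (hdist x y - 1) + (real n - real (hdist x y)) * f (hdist x y + 1)"
proof -
  let ?D = "{i. i < n \<and> x ! i \<noteq> y ! i}"
  have D: "card ?D = hdist x y" using assms by (simp add: hdist_def)
  have c: "card ({..<n} - ?D) = n - hdist x y"
    using card_Diff_subset[of ?D "{..<n}"] D by auto
  have "(\<Sum>i<n. f (hdist x (flip_at i y))) =
      (\<Sum>i\<in>{..<n} - ?D. f (hdist x (flip_at i y))) + (\<Sum>i\<in>?D. f (hdist x (flip_at i y)))"
    by (rule sum.subset_diff) auto
  also have "(\<Sum>i\<in>{..<n} - ?D. f (hdist x (flip_at i y))) = (\<Sum>i\<in>{..<n} - ?D. f (hdist x y + 1))"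
    by (rule sum.cong) (use assms in \<open>auto simp: hdist_flip_at\<close>)
  also have "(\<Sum>i\<in>?D. f (hdist x (flip_at i y))) = (\<Sum>i\<in>?D. f (hdist x y - 1))"
    by (rule sum.cong) (use assms in \<open>auto simp: hdist_flip_at\<close>)
  finally show ?thesis
    using hdist_le[of x y] assms by (simp only: sum_constant c D of_nat_diff)
qed

lemma sum_Pow_card:
  fixes f :: "nat \<Rightarrow> real"
  assumes "finite A"
  shows "(\<Sum>B\<in>Pow A. f (card B)) = (\<Sum>d\<le>card A. real (card A choose d) * f d)"
proof -
  have "(\<Sum>B\<in>Pow A. f (card B)) = (\<Sum>d\<le>card A. \<Sum>B\<in>{B \<in> Pow A. card B = d}. f (card B))"
    by (rule sum.group[symmetric]) (use assms card_mono in auto)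
  also have "\<dots> = (\<Sum>d\<le>card A. real (card A choose d) * f d)"
    by (rule sum.cong) (use n_subsets[OF assms] in auto)
  finally show ?thesis .
qed

text \<open>Encode \<open>y\<close> by the set of coordinates where it differs from
  \<open>x\<close>. This serves to average the total potential over all starting vertices of the
  robber.\<close>

lemma sum_hdist:
  fixes f :: "nat \<Rightarrow> real"
  assumes "length x = n"
  shows "(\<Sum>y | length (y :: bool list) = n. f (hdist x y)) = (\<Sum>d\<le>n. real (n choose d) * f d)"
proof -
  let ?D = "\<lambda>y. {i. i < n \<and> x ! i \<noteq> y ! i}"
  let ?L = "\<lambda>B. map (\<lambda>i. x ! i \<noteq> (i \<in> B)) [0..<n]"
  have "(\<Sum>y | length (y :: bool list) = n. f (hdist x y)) = (\<Sum>B\<in>Pow {..<n}. f (card B))"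
  proof (rule sum.reindex_bij_witness[where j = ?D and i = ?L])
    fix y :: "bool list" assume "y \<in> {y. length y = n}"
    then have y: "length y = n" by simp
    show "?L (?D y) = y" using y by (intro nth_equalityI) auto
    show "?D y \<in> Pow {..<n}" by auto
    show "f (card (?D y)) = f (hdist x y)" using assms by (simp only: hdist_def)
  next
    fix B assume "B \<in> Pow {..<n}"
    then show "?D (?L B) = B" by auto
    show "?L B \<in> {y. length y = n}" by simp
  qed
  then show ?thesis by (simp add: sum_Pow_card)
qed

text \<open>
  The robber keeps the total potential of the cops below 1, moving to a neighbour where it is
  at most average. \<open>g\<close> bounds the average contribution of the one cop that has just moved, and
  \<open>E\<close> is the error made by the others in the decay by the factor \<open>1 - \<delta> / n\<close>.
\<close>

lemma hypercube_robber_escapes: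
  fixes f :: "nat \<Rightarrow> real" and \<delta> E g :: real
  assumes f_nonneg: "\<And>d. f d \<ge> 0" and f0: "f 0 \<ge> 1" and f1: "f 1 \<ge> 1"
    and decay: "\<And>d. 2 \<le> d \<Longrightarrow> d \<le> n \<Longrightarrow>
      real d * f (d - 1) + (real n - real d) * f (d + 1) \<le> (real n - \<delta>) * f d + E"
    and gain: "\<And>d. 1 \<le> d \<Longrightarrow> d \<le> n \<Longrightarrow>
      real d * f (d - 1) + (real n - real d) * f (d + 1) \<le> g"
    and E: "E \<ge> 0" and g: "g \<ge> 0" and \<delta>: "\<delta> < real n"
    and budget: "g + real k * E \<le> \<delta>"
    and start: "real k * (\<Sum>d\<le>n. real (n choose d) * f d) < 2 ^ n"
  shows "\<not> winning_lazy_cop_strategy (hypercube n) k S"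
proof -
  define \<phi> where "\<phi> p v = (\<Sum>j<k. f (hdist (p ! j) v))" for p :: "bool list list" and v
  let ?safe = "\<lambda>p v. length p = k \<and> set p \<subseteq> pverts (hypercube n) \<and> v \<in> pverts (hypercube n) \<and> \<phi> p v < 1"
  have V: "pverts (hypercube n) = {x. length x = n}" by (simp add: hypercube_def)
  have cardV: "card {x :: bool list. length x = n} = 2 ^ n"
    using card_lists_length_eq[of "UNIV :: bool set" n] by simp
  \<comment> \<open>A single cop at distance 0 or 1 would already contribute 1.\<close>
  have far: "2 \<le> hdist (p ! j) v" if "\<phi> p v < 1" "j < k" for p v j
  proof -
    have "f (hdist (p ! j) v) \<le> \<phi> p v"
      unfolding \<phi>_def by (rule member_le_sum) (use that f_nonneg in auto)
    with that f0 f1 have "hdist (p ! j) v \<noteq> 0" "hdist (p ! j) v \<noteq> 1"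
      by (metis not_less order_trans)+
    then show ?thesis by linarith
  qed
  show ?thesis
  proof (rule not_winning_lazy_cop_strategy_if_safe[where safe = ?safe])
    fix u v assume "(u, v) \<in> parcs (hypercube n)"
    then show "v \<in> pverts (hypercube n)" by (simp add: arc_hypercube_iff V)
  next
    fix p assume p: "length p = k" "set p \<subseteq> pverts (hypercube n)"
    have pl: "length (p ! j) = n" if "j < k" for j
      using subsetD[OF p(2)] p(1) that unfolding V by auto
    have "(\<Sum>v | length v = n. \<phi> p v) = (\<Sum>j<k. \<Sum>v | length v = n. f (hdist (p ! j) v))"
      unfolding \<phi>_def by (rule sum.swap)
    also have "\<dots> = (\<Sum>j<k. \<Sum>d\<le>n. real (n choose d) * f d)"
      by (rule sum.cong) (use pl in \<open>auto simp: sum_hdist\<close>)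
    also have "\<dots> < 2 ^ n" using start by simp
    finally have less: "(\<Sum>v | length v = n. \<phi> p v) < 2 ^ n" .
    have "\<exists>v. length v = n \<and> \<phi> p v < 1"
    proof (rule ccontr)
      assume "\<not> ?thesis"
      then have "of_nat (card {v :: bool list. length v = n}) * 1 \<le> (\<Sum>v | length v = n. \<phi> p v)"
        by (intro sum_bounded_below) auto
      with less show False by (simp add: cardV)
    qed
    then show "\<exists>v\<in>pverts (hypercube n). ?safe p v" using p by (auto simp: V)
  next
    fix p v assume safe: "?safe p v"
    show "v \<notin> set p"
    proof
      assume "v \<in> set p"
      then obtain j where "j < k" "p ! j = v" using safe by (auto simp: in_set_conv_nth)
      then show False using far[of p v j] safe by simp
    qed
  next
    fix p q v
    assume p: "length p = k" "set p \<subseteq> pverts (hypercube n)"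
      and q: "set q \<subseteq> pverts (hypercube n)" and v: "v \<in> pverts (hypercube n)"
      and safe: "?safe p v" and move: "lazy_cop_move (hypercube n) p q"
    have lq: "length q = k" using move p unfolding lazy_cop_move_def by auto
    have ql: "length (q ! j) = n" if "j < k" for j
      using subsetD[OF q] lq that unfolding V by auto
    have pl: "length (p ! j) = n" if "j < k" for j
      using subsetD[OF p(2)] p(1) that unfolding V by auto
    have vl: "length v = n" using v by (simp add: V)
    \<comment> \<open>If no cop moves, any \<open>i\<close> will do, possibly one beyond
      \<open>k\<close>; so the charges \<open>g\<close> below sum to at most
      \<open>g\<close>.\<close>
    obtain i where i: "\<And>j. j < k \<Longrightarrow> j \<noteq> i \<Longrightarrow> q ! j = p ! j"
        "i < k \<Longrightarrow> q ! i = p ! i \<or> hdist (p ! i) (q ! i) = 1"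
      using move p unfolding lazy_cop_move_def arc_hypercube_iff
      by (metis nth_list_update_eq nth_list_update_neq)
    \<comment> \<open>The moving cop started at distance at least 2. Hence \<open>gain\<close> has
      to cover distance 1, while \<open>decay\<close> starts at 2.\<close>
    have near: "1 \<le> hdist (q ! j) v" if j: "j < k" for j
    proof -
      have "q ! j \<noteq> v" using i j far[of p v j] safe by (cases "j = i") auto
      then show ?thesis using hdist_eq_0_iff[of "q ! j" v] ql[OF j] vl by simp
    qed
    let ?A = "\<lambda>d. real d * f (d - 1) + (real n - real d) * f (d + 1)"
    have bound: "?A (hdist (q ! j) v) \<le>
        (real n - \<delta>) * f (hdist (p ! j) v) + E + (if j = i then g else 0)" if j: "j < k" for j
    proof (cases "j = i")
      case True
      have "?A (hdist (q ! j) v) \<le> g"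
        using gain near[OF j] hdist_le[of "q ! j" v] ql[OF j] by simp
      \<comment> \<open>The old term of the moved cop is added for free, to complete the sum over
        all cops to a multiple of \<open>\<phi> p v\<close>.\<close>
      moreover have "0 \<le> (real n - \<delta>) * f (hdist (p ! j) v)"
        using \<delta> f_nonneg by simp
      ultimately show ?thesis using True E by simp
    next
      case False
      have "2 \<le> hdist (p ! j) v" using far[OF _ j] safe by blast
      moreover have "hdist (p ! j) v \<le> n" using hdist_le[of "p ! j" v] pl[OF j] by simp
      ultimately have "?A (hdist (p ! j) v) \<le> (real n - \<delta>) * f (hdist (p ! j) v) + E"
        by (rule decay)
      then show ?thesis unfolding i(1)[OF j False] using False by simp
    qed
    have "(\<Sum>l<n. \<phi> q (flip_at l v)) = (\<Sum>j<k. \<Sum>l<n. f (hdist (q ! j) (flip_at l v)))"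
      unfolding \<phi>_def by (rule sum.swap)
    also have "\<dots> = (\<Sum>j<k. ?A (hdist (q ! j) v))"
      by (rule sum.cong) (use ql vl in \<open>auto simp: sum_flip_at\<close>)
    also have "\<dots> \<le> (\<Sum>j<k. (real n - \<delta>) * f (hdist (p ! j) v) + E + (if j = i then g else 0))"
      by (rule sum_mono) (use bound in blast)
    also have "\<dots> \<le> (real n - \<delta>) * \<phi> p v + real k * E + g"
      using g by (simp add: sum.distrib \<phi>_def sum_distrib_left sum.delta)
    also have "\<dots> < real n"
    proof -
      have "(real n - \<delta>) * \<phi> p v < (real n - \<delta>) * 1"
        using safe \<delta> by (intro mult_strict_left_mono) auto
      with budget show ?thesis by simp
    qed
    finally have less: "(\<Sum>l<n. \<phi> q (flip_at l v)) < real n" .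
    have "\<exists>l<n. \<phi> q (flip_at l v) < 1"
    proof (rule ccontr)
      assume "\<not> ?thesis"
      then have "of_nat (card {..<n}) * 1 \<le> (\<Sum>l<n. \<phi> q (flip_at l v))"
        by (intro sum_bounded_below) auto
      with less show False by simp
    qed
    moreover have "v \<notin> set q"
    proof
      assume "v \<in> set q"
      then obtain j where "j < k" "q ! j = v" using lq by (auto simp: in_set_conv_nth)
      then show False using near[of j] by simp
    qed
    moreover have "flip_at l v \<in> pverts (hypercube n)" for l using vl by (simp add: V)
    ultimately show "v \<notin> set q \<and> (\<exists>v'. (v, v') \<in> parcs (hypercube n) \<and> ?safe q v')"
      using arc_flip_at[OF vl] lq q by blast
  qed
qed


section \<open>A superharmonic potential below the middle level\<close>

text \<open>Superharmonicity at gap s = n - 2 d, without the common factor. After clearing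
  denominators and halving, the constant 7/2 instead of 4 leaves a slack of s^6 / 2, which has to
  absorb 24 n s^4; this forces s to be at least of order sqrt n.\<close>

lemma potential_polynomial_ineq:
  fixes n s :: real
  assumes s: "s \<ge> 3" and sn: "48 * n + 32 \<le> s\<^sup>2" and n: "n \<ge> 0"
  shows "(n + 2 + s) / (s + 2) ^ 3 + (n + 2 - s) / (s - 2) ^ 3 \<le> 2 * (n - 7/2) / s ^ 3"
proof -
  have t: "9 \<le> s\<^sup>2" using s power_mono[of 3 s 2] by simp
  have "s ^ 4 * (48 * n + 32) \<le> s ^ 4 * s\<^sup>2"
    using sn by (intro mult_left_mono) auto
  then have 1: "48 * (n * s ^ 4) + 32 * s ^ 4 \<le> s ^ 6"
    by (simp add: algebra_simps flip: power_add)
  have 2: "64 * n \<le> 48 * (n * s\<^sup>2)"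
    using mult_left_mono[of 64 "48 * s\<^sup>2" n] t n by (simp add: algebra_simps)
  have "s\<^sup>2 * 4 \<le> s\<^sup>2 * s\<^sup>2" using t by (intro mult_left_mono) auto
  then have 3: "4 * s\<^sup>2 \<le> s ^ 4" by (simp add: flip: power_add)
  \<comment> \<open>Here a, ..., f stand for the monomials s^2, s^6, n s^4, s^4, n s^6, n s^2, which
    makes the comparison linear.\<close>
  have lin: "2 * (e - 4 * b + 12 * c + 16 * d) \<le> 2 * (e - 12 * c + 48 * f - 64 * n - 7/2 * b + 42 * d - 168 * a + 224)"
    if "48 * c + 32 * d \<le> b" "64 * n \<le> 48 * f" "4 * a \<le> d" for a b c d e f :: real
    using that by simp
  have "(n + 2 + s) * (s - 2) ^ 3 * s ^ 3 + (n + 2 - s) * (s + 2) ^ 3 * s ^ 3 =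
      2 * (n * s ^ 6 - 4 * s ^ 6 + 12 * (n * s ^ 4) + 16 * s ^ 4)"
    by algebra
  also have "\<dots> \<le> 2 * (n * s ^ 6 - 12 * (n * s ^ 4) + 48 * (n * s\<^sup>2) - 64 * n
       - 7/2 * s ^ 6 + 42 * s ^ 4 - 168 * s\<^sup>2 + 224)"
    using lin[OF 1 2 3] .
  also have "\<dots> = 2 * (n - 7/2) * ((s + 2) ^ 3 * (s - 2) ^ 3)"
    by algebra
  finally show ?thesis
    using s by (simp add: divide_simps) (simp add: algebra_simps)
qed

text \<open>With s = n - 2 d this says that the potential does not increase from level d to d + 1.
  In the difference of the sides, 2 s^4 outweighs 6 n s^2.\<close>

lemma monotone_polynomial_ineq:
  fixes n s :: real
  assumes s: "s \<ge> 10" and sn: "48 * n \<le> s\<^sup>2" and n: "n \<ge> 0"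
  shows "(n - s + 2) * s ^ 3 \<le> (n + s) * (s - 2) ^ 3"
proof -
  have "s\<^sup>2 * (48 * n) \<le> s\<^sup>2 * s\<^sup>2" using sn by (intro mult_left_mono) auto
  then have 1: "48 * (n * s\<^sup>2) \<le> s ^ 4" by (simp add: mult_ac flip: power_add)
  have "s ^ 3 * 10 \<le> s ^ 3 * s" using s by (intro mult_left_mono) auto
  then have 2: "10 * s ^ 3 \<le> s ^ 4" by (simp add: power_numeral_reduce mult_ac)
  have "s * 10 \<le> s * s" using s by (intro mult_left_mono) auto
  then have 3: "10 * s \<le> s\<^sup>2" by (simp add: power2_eq_square)
  have 4: "n * 10 \<le> n * s" using s n by (intro mult_left_mono) auto
  have "(n + s) * (s - 2) ^ 3 - (n - s + 2) * s ^ 3 =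
     2 * s ^ 4 - 8 * s ^ 3 + 12 * s\<^sup>2 - 8 * s - 6 * (n * s\<^sup>2) + 12 * (n * s) - 8 * n"
    by algebra
  moreover have "0 \<le> s ^ 4" "0 \<le> s\<^sup>2" by simp_all
  ultimately show ?thesis using 1 2 3 4 s n by linarith
qed

text \<open>
  The equation \<open>d u (d - 1) + (n - d) u (d + 1) = n u d\<close> has approximately the solution \<open>1 / (n choose d)\<close>
  away from the middle level. The factor \<open>(n - 2 d)\<^sup>-\<^sup>p\<close> improves \<open>n\<close> on the right to
  \<open>n - (2 p - 2)\<close> up to lower order terms, and \<open>p = 3\<close> is the least integer for which this beats
  the gain of the moving cop. The numerator normalises \<open>pot n 1 = 1\<close>.
\<close>

definition pot :: "nat \<Rightarrow> nat \<Rightarrow> real" where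
  "pot n d = real n * (real n - 2) ^ 3 / ((real n - 2 * real d) ^ 3 * real (n choose d))"

section \<open>Comparing \<open>pot\<close> on neighbouring levels\<close>

lemma choose_Suc_mult: "real (n choose Suc d) * real (Suc d) = real (n choose d) * (real n - real d)"
proof (cases "d \<le> n")
  case True
  have "(n choose Suc d) * Suc d = (n choose d) * (n - d)"
    using binomial_absorb_comp[of n d] binomial_absorption[of d n] True
    by (metis Suc_times_binomial_eq binomial_absorption mult.commute)
  then show ?thesis using True by (metis of_nat_diff of_nat_mult)
qed (simp add: binomial_eq_0)


text \<open>Normal form with a prefactor shared by the terms of levels d - 1, d and d + 1, so that
  comparing them only involves rational functions of n and the gap s. The 2 clears halves as in n -
  d + 1 = (n + 2 + s) / 2.\<close>

lemma mult_pot: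
  "x * pot n d = real n * (real n - 2) ^ 3 / (2 * real (n choose d)) * (2 * x / (real n - 2 * real d) ^ 3)"
proof -
  have "x * (a / (t * b)) = a / (2 * b) * (2 * x / t)" for a b t :: real
    by (cases "b = 0"; cases "t = 0") (simp_all add: field_simps)
  then show ?thesis unfolding pot_def .
qed

lemma pot_nonneg:
  assumes "2 * d < n" "2 \<le> n"
  shows "pot n d \<ge> 0"
proof -
  have "real (2 * d) < real n" using assms by linarith
  then show ?thesis using assms by (simp add: pot_def)
qed

lemma
  assumes "10 * sqrt (real n) \<le> real n - 2 * real d" "1 \<le> n"
  shows gap_ge_10: "10 \<le> real n - 2 * real d"
    and gap_power2: "100 * real n \<le> (real n - 2 * real d)\<^sup>2"
    and gap_less: "2 * d < n"
    and gap_n: "10 \<le> n"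
proof -
  have "1 \<le> sqrt (real n)" using assms by simp
  then show 1: "10 \<le> real n - 2 * real d" using assms by linarith
  then show "2 * d < n" "10 \<le> n" by linarith+
  have "(10 * sqrt (real n))\<^sup>2 \<le> (real n - 2 * real d)\<^sup>2"
    using assms by (intro power_mono) auto
  then show "100 * real n \<le> (real n - 2 * real d)\<^sup>2"
    by (simp add: power_mult_distrib)
qed

lemma mult_pot_pred:
  assumes "1 \<le> d" "2 * d < n"
  shows "real d * pot n (d - 1) = real n * (real n - 2) ^ 3 / (2 * real (n choose d)) *
    ((real n + 2 + (real n - 2 * real d)) / (real n - 2 * real d + 2) ^ 3)"
proof -
  obtain e where e: "d = Suc e" using assms by (cases d) auto
  have B: "real (n choose d) > 0" using assms by simp
  have C: "real (n choose e) > 0" using assms e by simp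
  have pos: "real n - 2 * real d > 0" using assms by linarith
  have *: "real (n choose d) * real d = real (n choose e) * (real n - real e)"
    unfolding e by (rule choose_Suc_mult)
  have gap: "real n - 2 * real (d - 1) = real n - 2 * real d + 2" by (simp add: e)
  have "real d / real (n choose e) = (real n - real d + 1) / real (n choose d)"
    using * B C by (simp add: field_simps e)
  moreover have "real d * pot n (d - 1) = real n * (real n - 2) ^ 3 / (real n - 2 * real d + 2) ^ 3 *
      (real d / real (n choose e))"
    unfolding pot_def gap by (simp add: e mult_ac)
  ultimately have "real d * pot n (d - 1) = real n * (real n - 2) ^ 3 / (real n - 2 * real d + 2) ^ 3 *
      ((real n - real d + 1) / real (n choose d))"
    by (simp only:)
  also have "real n - real d + 1 = (real n + 2 + (real n - 2 * real d)) / 2" by simp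
  finally show ?thesis by simp
qed

lemma mult_pot_Suc:
  assumes "2 * d + 2 < n"
  shows "(real n - real d) * pot n (d + 1) = real n * (real n - 2) ^ 3 / (2 * real (n choose d)) *
    ((real n + 2 - (real n - 2 * real d)) / (real n - 2 * real d - 2) ^ 3)"
proof -
  have B: "real (n choose d) > 0" "real (n choose Suc d) > 0" using assms by simp_all
  have *: "real (n choose Suc d) * real (Suc d) = real (n choose d) * (real n - real d)"
    by (rule choose_Suc_mult)
  have gap: "real n - 2 * real (d + 1) = real n - 2 * real d - 2" by simp
  have "(real n - real d) / real (n choose Suc d) = real (Suc d) / real (n choose d)"
    using * B by (simp add: field_simps)
  moreover have "(real n - real d) * pot n (d + 1) = real n * (real n - 2) ^ 3 / (real n - 2 * real d - 2) ^ 3 *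
      ((real n - real d) / real (n choose Suc d))"
    unfolding pot_def gap by (simp add: mult_ac)
  ultimately have "(real n - real d) * pot n (d + 1) = real n * (real n - 2) ^ 3 / (real n - 2 * real d - 2) ^ 3 *
      (real (Suc d) / real (n choose d))"
    by (simp only:)
  also have "real (Suc d) = (real n + 2 - (real n - 2 * real d)) / 2" by simp
  finally show ?thesis by simp
qed

lemma pot_superharmonic:
  assumes gap: "10 * sqrt (real n) \<le> real n - 2 * real d" and n: "1 \<le> n" and d: "1 \<le> d"
  shows "real d * pot n (d - 1) + (real n - real d) * pot n (d + 1) \<le> (real n - 7/2) * pot n d"
proof -
  note g = gap_ge_10[OF gap n] gap_power2[OF gap n] gap_less[OF gap n] gap_n[OF gap n]
  let ?s = "real n - 2 * real d" and ?c = "real n * (real n - 2) ^ 3 / (2 * real (n choose d))"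
  have "2 * d + 2 < n" using g(1) by linarith
  then have "real d * pot n (d - 1) + (real n - real d) * pot n (d + 1) =
      ?c * ((real n + 2 + ?s) / (?s + 2) ^ 3 + (real n + 2 - ?s) / (?s - 2) ^ 3)"
    using mult_pot_pred[OF d] mult_pot_Suc[of d n] by (simp only: distrib_left)
  also have "\<dots> \<le> ?c * (2 * (real n - 7/2) / ?s ^ 3)"
    using g by (intro mult_left_mono potential_polynomial_ineq) auto
  also have "\<dots> = (real n - 7/2) * pot n d"
    by (rule mult_pot[symmetric])
  finally show ?thesis .
qed

lemma pot_Suc_le:
  assumes gap: "10 * sqrt (real n) \<le> real n - 2 * real d" and n: "1 \<le> n"
  shows "pot n (d + 1) \<le> pot n d"
proof -
  note g = gap_ge_10[OF gap n] gap_power2[OF gap n] gap_less[OF gap n] gap_n[OF gap n]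
  let ?s = "real n - 2 * real d" and ?c = "real n * (real n - 2) ^ 3 / (2 * real (n choose d))"
  have c: "?c \<ge> 0" using g by simp
  have s: "?s - 2 > 0" using g by linarith
  have "(real n - ?s + 2) * ?s ^ 3 \<le> (real n + ?s) * (?s - 2) ^ 3"
    using g by (intro monotone_polynomial_ineq) auto
  then have "(real n + 2 - ?s) / (?s - 2) ^ 3 \<le> (real n + ?s) / ?s ^ 3"
    using s by (subst pos_divide_le_eq) (simp_all add: pos_le_divide_eq add_ac algebra_simps)
  then have "?c * ((real n + 2 - ?s) / (?s - 2) ^ 3) \<le> ?c * ((real n + ?s) / ?s ^ 3)"
    using c by (rule mult_left_mono)
  moreover have "(real n - real d) * pot n (d + 1) = ?c * ((real n + 2 - ?s) / (?s - 2) ^ 3)"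
    using g by (intro mult_pot_Suc) linarith
  moreover have "?c * ((real n + ?s) / ?s ^ 3) = (real n - real d) * pot n d"
    by (subst mult_pot) simp
  ultimately have "(real n - real d) * pot n (d + 1) \<le> (real n - real d) * pot n d" by simp
  moreover have "real n - real d > 0" using g by linarith
  ultimately show ?thesis by simp
qed

lemma pot_antimono:
  assumes gap: "10 * sqrt (real n) \<le> real n - 2 * real e" and n: "1 \<le> n" and "d \<le> e"
  shows "pot n e \<le> pot n d"
  using \<open>d \<le> e\<close> gap
proof (induction e rule: dec_induct)
  case (step e)
  then have "10 * sqrt (real n) \<le> real n - 2 * real e" by simp
  with step pot_Suc_le[OF this n] show ?case by simp
qed simp

text \<open>Replaces the gap s + 2 of level d - 1 by s, so that only the ratio of the binomials
  remains. It controls the clamped potential at level \<open>m\<close>.\<close>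

lemma pot_pred_le:
  assumes "1 \<le> d" "2 * d < n"
  shows "real d * pot n (d - 1) \<le> (real n - real d + 1) * pot n d"
proof -
  let ?s = "real n - 2 * real d" and ?c = "real n * (real n - 2) ^ 3 / (2 * real (n choose d))"
  have s: "?s > 0" using assms by linarith
  have "(?s) ^ 3 \<le> (?s + 2) ^ 3" using s by (intro power_mono) auto
  then have "(real n + 2 + ?s) / (?s + 2) ^ 3 \<le> (real n + 2 + ?s) / ?s ^ 3"
    using s by (intro divide_left_mono) auto
  then have "?c * ((real n + 2 + ?s) / (?s + 2) ^ 3) \<le> ?c * ((real n + 2 + ?s) / ?s ^ 3)"
    using assms by (intro mult_left_mono) auto
  also have "\<dots> = (real n - real d + 1) * pot n d"
    by (subst mult_pot) simp
  finally show ?thesis using mult_pot_pred[OF assms] by simp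
qed

lemma pot_1: "n > 2 \<Longrightarrow> pot n 1 = 1"
  by (simp add: pot_def)

text \<open>The limit is 2. Any bound that keeps the gain, about 1 + n \<open>pot n 2\<close>,
  clearly below 7/2 would serve.\<close>

lemma pot_2_le:
  assumes "n \<ge> 1000"
  shows "real n * pot n 2 \<le> 21/10"
proof -
  define x where "x = real n - 4"
  have x: "x \<ge> 996" using assms by (simp add: x_def)
  have C: "real (n choose 2) = real n * (real n - 1) / 2"
    using assms choose_Suc_mult[of n 1] by (simp add: numeral_2_eq_2)
  have "x + 2 \<le> (1.003) * x" using x by simp
  then have "(x + 2) ^ 3 \<le> (1.003 * x) ^ 3" using x by (intro power_mono) auto
  also have "\<dots> \<le> 1.01 * x ^ 3" using x by (simp add: power_mult_distrib power3_eq_cube)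
  finally have "2 * (x + 2) ^ 3 / x ^ 3 \<le> 2.02" using x by (simp add: pos_divide_le_eq)
  moreover have "real n / (real n - 1) \<le> 1.01" using assms by (simp add: pos_divide_le_eq)
  ultimately have "(2 * (x + 2) ^ 3 / x ^ 3) * (real n / (real n - 1)) \<le> 2.02 * 1.01"
    using assms x by (intro mult_mono) auto
  moreover have "real n * pot n 2 = (2 * (x + 2) ^ 3 / x ^ 3) * (real n / (real n - 1))"
    using assms by (simp add: pot_def C x_def)
  ultimately show ?thesis by simp
qed

text \<open>
  Levels beyond \<open>m\<close> are clamped to \<open>pot n m\<close> rather than to 0: the error at \<open>m\<close> is then governed by
  the slope of \<open>pot n\<close> instead of its value, which saves a factor \<open>sqrt n\<close>.
\<close>

context
  fixes n m :: nat and f :: "nat \<Rightarrow> real"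
  assumes n: "n \<ge> 1000" and m: "m \<ge> 3" and gap: "10 * sqrt (real n) \<le> real n - 2 * real m"
  defines "f \<equiv> \<lambda>d. pot n (max 1 (min d m))"
begin

lemma clamp_gap: "d \<le> m \<Longrightarrow> 10 * sqrt (real n) \<le> real n - 2 * real d"
  using gap by linarith

lemma clamp_nonneg: "f d \<ge> 0"
proof -
  have "max 1 (min d m) \<le> m" using m by auto
  from clamp_gap[OF this] show ?thesis
    unfolding f_def using n by (intro pot_nonneg gap_less) auto
qed

lemma clamp_0: "f 0 = 1" and clamp_1: "f 1 = 1"
  using n m pot_1[of n] by (simp_all add: f_def)

lemma clamp_mid: "1 \<le> d \<Longrightarrow> d \<le> m \<Longrightarrow> f d = pot n d"
  by (simp add: f_def max_absorb2)

lemma clamp_top: "m \<le> d \<Longrightarrow> f d = pot n m"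
  using m by (simp add: f_def max_absorb2)

lemma clamp_antimono: "d \<le> e \<Longrightarrow> f e \<le> f d"
  unfolding f_def using n m by (intro pot_antimono clamp_gap) auto

lemma clamp_superharmonic:
  assumes "2 \<le> d" "d < m"
  shows "real d * f (d - 1) + (real n - real d) * f (d + 1) \<le> (real n - 7/2) * f d"
  using pot_superharmonic[OF clamp_gap, of d] assms n by (simp add: clamp_mid)

text \<open>The error arises at d = m, where the neighbours sum to at most (2 n - 2 m + 1)
  \<open>pot n m\<close>, which exceeds (n - 7/2) \<open>pot n m\<close> by exactly the error term.
  Beyond \<open>m\<close>, constancy costs only 7/2 \<open>pot n m\<close>.\<close>

lemma clamp_decay:
  assumes "2 \<le> d"
  shows "real d * f (d - 1) + (real n - real d) * f (d + 1) \<le>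
    (real n - 7/2) * f d + pot n m * (real n - 2 * real m + 9/2)"
proof -
  have pm: "pot n m \<ge> 0" using clamp_nonneg[of m] clamp_top[of m] by simp
  have s: "real n - 2 * real m \<ge> 0" using gap_ge_10[OF gap] n by simp
  consider "d < m" | "d = m" | "d > m" by linarith
  then show ?thesis
  proof cases
    case 1
    have "0 \<le> pot n m * (real n - 2 * real m + 9/2)" using pm s by simp
    then show ?thesis using clamp_superharmonic[OF assms 1] by linarith
  next
    case 2
    have "real m * pot n (m - 1) \<le> (real n - real m + 1) * pot n m"
      using m n gap_less[OF gap] by (intro pot_pred_le) auto
    moreover have "f (d - 1) = pot n (m - 1)" "f d = pot n m" "f (d + 1) = pot n m"
      using 2 m by (simp_all add: clamp_top clamp_mid)
    ultimately show ?thesis using 2 by (simp add: algebra_simps)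
  next
    case 3
    have "f (d - 1) = pot n m" "f d = pot n m" "f (d + 1) = pot n m"
      using 3 by (simp_all add: clamp_top)
    moreover have "0 \<le> pot n m * (real n - 2 * real m)" using pm s by simp
    ultimately show ?thesis using pm by (simp add: algebra_simps)
  qed
qed

text \<open>Distance 1 is the worst case, with f 0 + (n - 1) f 2. At distance 2 monotonicity alone
  would give about 4, so superharmonicity is used there.\<close>

lemma clamp_gain:
  assumes d: "1 \<le> d" "d \<le> n"
  shows "real d * f (d - 1) + (real n - real d) * f (d + 1) \<le> 31/10"
proof -
  have f2: "f 2 = pot n 2" using m by (simp add: clamp_mid)
  have n2: "real n * f 2 \<le> 21/10" using pot_2_le[OF n] by (simp add: f2)
  have nn: "0 \<le> f 2" by (rule clamp_nonneg)
  consider "d = 1" | "d = 2" | "d \<ge> 3" using d by linarith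
  then show ?thesis
  proof cases
    case 1
    have "(real n - 1) * f 2 \<le> 21/10" using n2 nn by (simp add: algebra_simps)
    then show ?thesis using 1 by (simp add: clamp_0 numeral_2_eq_2)
  next
    case 2
    then show ?thesis using clamp_superharmonic[of 2] m n2 nn by (simp add: algebra_simps)
  next
    case 3
    have "real d * f (d - 1) + (real n - real d) * f (d + 1) \<le> real d * f 2 + (real n - real d) * f 2"
      using 3 d by (intro add_mono mult_left_mono clamp_antimono) auto
    also have "\<dots> = real n * f 2" by (simp add: algebra_simps)
    finally show ?thesis using n2 by simp
  qed
qed

text \<open>Up to level \<open>m\<close> the binomial cancels against the one in \<open>pot\<close>;
  above it the potential is constant and the binomials sum to at most 2^n.\<close>

lemma clamp_sum:
  "(\<Sum>d\<le>n. real (n choose d) * f d) \<le> 1 + real n * (real n ^ 4 / (real n - 2 * real m) ^ 3) + 2 ^ n * pot n m"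
proof -
  let ?s = "real n - 2 * real m"
  have pm: "pot n m \<ge> 0" using clamp_nonneg[of m] clamp_top[of m] by simp
  have s: "?s > 0" using gap_ge_10[OF gap] n by simp
  have summand: "real (n choose d) * f d \<le> real n ^ 4 / ?s ^ 3 + real (n choose d) * pot n m"
    if d: "d \<in> {1..n}" for d
  proof (cases "d \<le> m")
    case True
    have le: "?s \<le> real n - 2 * real d" using True by simp
    have "real (n choose d) * f d = real n * (real n - 2) ^ 3 / (real n - 2 * real d) ^ 3"
      using True d s le by (simp add: clamp_mid pot_def)
    also have "\<dots> \<le> real n * real n ^ 3 / ?s ^ 3"
      using s le n by (intro frac_le mult_left_mono power_mono mult_nonneg_nonneg) auto
    also have "\<dots> = real n ^ 4 / ?s ^ 3" by (simp add: power_numeral_reduce)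
    finally show ?thesis using pm by (simp add: add_increasing2)
  next
    case False
    then show ?thesis using s by (simp add: clamp_top)
  qed
  have "(\<Sum>d\<le>n. real (n choose d) * f d) = 1 + (\<Sum>d\<in>{1..n}. real (n choose d) * f d)"
    unfolding atMost_atLeast0 by (subst sum.atLeast_Suc_atMost) (simp_all add: clamp_0)
  also have "\<dots> \<le> 1 + (\<Sum>d\<in>{1..n}. real n ^ 4 / ?s ^ 3 + real (n choose d) * pot n m)"
    by (intro add_left_mono sum_mono summand)
  also have "\<dots> = 1 + real n * (real n ^ 4 / ?s ^ 3) + (\<Sum>d\<in>{1..n}. real (n choose d)) * pot n m"
    by (simp add: sum.distrib sum_distrib_right)
  also have "(\<Sum>d\<in>{1..n}. real (n choose d)) \<le> (\<Sum>d\<le>n. real (n choose d))"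
    by (intro sum_mono2) auto
  also have "(\<Sum>d\<le>n. real (n choose d)) = 2 ^ n"
    by (metis choose_row_sum of_nat_numeral of_nat_power of_nat_sum)
  finally show ?thesis using pm by (simp add: mult_right_mono)
qed

end


section \<open>Binomial coefficients near the middle\<close>

text \<open>The induction step amounts to a (a + 1) <= (a + 1/2)^2. The order sqrt a matters, as it
  enters the final exponent 7/2.\<close>

lemma central_binomial_ge_sqrt:
  assumes "1 \<le> a"
  shows "4 ^ a \<le> 2 * sqrt (real a) * real ((2 * a) choose a)"
  using assms
proof (induction a rule: dec_induct)
  case (step a)
  have r: "sqrt (real a) * (real a + 1) \<le> sqrt (real a + 1) * (real a + 1/2)"
  proof (rule power2_le_imp_le)
    show "(sqrt (real a) * (real a + 1))\<^sup>2 \<le> (sqrt (real a + 1) * (real a + 1/2))\<^sup>2"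
      by (simp add: power_mult_distrib) (simp add: power2_eq_square algebra_simps)
  qed simp
  let ?C = "real ((2 * a) choose a)" and ?D = "real (Suc (2 * a) choose a)"
    and ?C' = "real ((2 * Suc a) choose Suc a)"
  have "?C' * real (Suc a) = (2 * ?D) * real (Suc a)"
    using arg_cong[OF Suc_times_binomial[of a "Suc (2 * a)"], of real] by (simp add: algebra_simps)
  then have C': "?C' = 2 * ?D" by (simp only: mult_cancel_right) simp
  have "Suc (2 * a) choose a = Suc (2 * a) choose Suc a"
    by (subst binomial_symmetric) simp_all
  then have D: "(real a + 1) * ?D = (2 * real a + 1) * ?C"
    using arg_cong[OF Suc_times_binomial[of a "2 * a"], of real] by (simp add: algebra_simps)
  have "(real a + 1) * 4 ^ Suc a \<le> (real a + 1) * (8 * sqrt (real a) * ?C)"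
    using step.IH by (intro mult_left_mono) auto
  also have "\<dots> \<le> 8 * ?C * (sqrt (real a + 1) * (real a + 1/2))"
    using mult_left_mono[OF r, of "8 * ?C"] by (simp add: mult_ac)
  also have "\<dots> = 4 * sqrt (real a + 1) * ((2 * real a + 1) * ?C)" by algebra
  also have "\<dots> = (real a + 1) * (2 * sqrt (real (Suc a)) * ?C')"
    unfolding D[symmetric] C' by (simp add: add.commute)
  finally show ?case by (subst (asm) mult_le_cancel_left_pos) simp_all
qed simp

lemma middle_binomial_ge_sqrt:
  assumes "1 \<le> n"
  shows "2 ^ n \<le> 2 * sqrt (real n) * real (n choose (n div 2))"
proof (cases "even n")
  case True
  then obtain a where a: "n = 2 * a" by blast
  have "4 ^ a \<le> 2 * sqrt (real a) * real ((2 * a) choose a)"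
    using assms a by (intro central_binomial_ge_sqrt) simp
  also have "\<dots> \<le> 2 * sqrt (real n) * real ((2 * a) choose a)"
    using a by (intro mult_right_mono) auto
  finally show ?thesis by (simp add: a power_mult)
next
  case False
  then obtain a where a: "n = Suc (2 * a)" by (auto elim: oddE)
  have sym: "n choose Suc a = n choose a"
    using central_binomial_odd[OF False] by (simp add: a)
  \<comment> \<open>Odd rows reduce to the central coefficient of the next row.\<close>
  have "(2 * Suc a) choose Suc a = 2 * (n choose a)"
    using sym by (simp add: a)
  moreover have "4 ^ Suc a \<le> 2 * sqrt (real (Suc a)) * real ((2 * Suc a) choose Suc a)"
    by (intro central_binomial_ge_sqrt) simp
  ultimately have "4 ^ Suc a \<le> 4 * sqrt (real (Suc a)) * real (n choose a)"
    by simp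
  moreover have "(2::real) * 2 ^ n = 4 ^ Suc a" by (simp add: a power_mult)
  ultimately have "2 ^ n \<le> 2 * sqrt (real (Suc a)) * real (n choose a)"
    by linarith
  also have "\<dots> \<le> 2 * sqrt (real n) * real (n choose a)"
    using a by (intro mult_right_mono) auto
  finally show ?thesis by (simp add: a)
qed

text \<open>For m <= k below the middle, n - k >= n / 2 gives x (n - k) <= (n - k) - (n - 2 m) <= k
  + 1. So each step up multiplies the binomial by at most 1 / x.\<close>

lemma binomial_below_middle_ge:
  fixes n m j :: nat
  defines "x \<equiv> 1 - 2 * (real n - 2 * real m) / real n"
  assumes x: "0 \<le> x" and n: "0 < n" and "m + j \<le> n div 2"
  shows "real (n choose (m + j)) * x ^ j \<le> real (n choose m)"
  using \<open>m + j \<le> n div 2\<close>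
proof (induction j)
  case (Suc j)
  let ?k = "m + j"
  have "2 * ?k + 2 \<le> n" using Suc.prems by presburger
  then have k: "2 * real ?k + 2 \<le> real n" by linarith
  have gap: "0 \<le> real n - 2 * real m" using k by simp
  define y where "y = 2 * (real n - 2 * real m) / real n"
  have "y * (real n / 2) \<le> y * (real n - real ?k)"
    using k gap unfolding y_def by (intro mult_left_mono divide_nonneg_nonneg) auto
  moreover have "y * (real n / 2) = real n - 2 * real m" using n by (simp add: y_def)
  moreover have "x * (real n - real ?k) = (real n - real ?k) - y * (real n - real ?k)"
    by (simp add: x_def y_def algebra_simps)
  ultimately have "x * (real n - real ?k) \<le> real (Suc ?k)" by simp
  then have "real (n choose ?k) * (x * (real n - real ?k)) \<le> real (n choose ?k) * real (Suc ?k)"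
    by (rule mult_left_mono) simp
  also have "real (n choose ?k) * (x * (real n - real ?k)) = real (n choose Suc ?k) * real (Suc ?k) * x"
    unfolding choose_Suc_mult by (simp add: mult_ac)
  finally have "(real (n choose Suc ?k) * x) * real (Suc ?k) \<le> real (n choose ?k) * real (Suc ?k)"
    by (simp only: mult_ac)
  then have "real (n choose Suc ?k) * x \<le> real (n choose ?k)"
    by (rule mult_right_le_imp_le) simp
  then have "(real (n choose Suc ?k) * x) * x ^ j \<le> real (n choose ?k) * x ^ j"
    using x by (intro mult_right_mono) auto
  also have "\<dots> \<le> real (n choose m)" using Suc by simp
  finally show ?case by (simp add: mult_ac)
qed simp

text \<open>Going down from the middle takes at most 5 (q + 1) <= 6 q steps, each costing a factor
  of at least exp (-44 / q); 44 * 6 = 264.\<close>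

lemma binomial_sqrt_below_middle:
  fixes n :: nat
  defines "q \<equiv> sqrt (real n)"
  defines "m \<equiv> n div 2 - 5 * nat \<lceil>q\<rceil>"
  assumes n: "n \<ge> 1000000"
  shows "3 \<le> m" "10 * q \<le> real n - 2 * real m" "real n - 2 * real m \<le> 11 * q"
    and "exp (-264) / 2 * 2 ^ n / q \<le> real (n choose m)"
proof -
  define r where "r = nat \<lceil>q\<rceil>"
  have q: "q \<ge> 1000"
    unfolding q_def using n by (intro real_le_rsqrt) simp
  have qq: "real n = q * q" unfolding q_def by simp
  have "1000 * q \<le> q * q" using q by (intro mult_right_mono) auto
  then have q1000: "1000 * q \<le> real n" by (simp add: qq)
  have r: "q \<le> real r" "real r \<le> q + 1"
    unfolding r_def using q by linarith+
  have m: "m + 5 * r = n div 2" "3 \<le> m"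
    using r q1000 q unfolding m_def r_def[symmetric] by linarith+
  show "3 \<le> m" by fact
  show gap: "10 * q \<le> real n - 2 * real m" "real n - 2 * real m \<le> 11 * q"
    using m r q by linarith+
  define x where "x = 1 - 2 * (real n - 2 * real m) / real n"
  have "2 * (real n - 2 * real m) / real n \<le> 2 * (11 * q) / real n"
    using gap by (intro divide_right_mono) auto
  also have "\<dots> = 22 / q" using q by (simp add: qq)
  finally have x: "1 - 22 / q \<le> x" by (simp add: x_def)
  have small: "22 / q \<le> 1 / 2" using q by (simp add: field_simps)
  \<comment> \<open>For 0 <= y <= 1/2, ln (1 - y) >= - y - 2 y^2 >= - 2 y, here with y = 22 /
    q.\<close>
  have "-44 / q \<le> - (22 / q) - 2 * (22 / q)\<^sup>2"
  proof -
    have "2 * ((22 / q) * (22 / q)) \<le> 2 * ((22 / q) * (1 / 2))"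
      using small q by (intro mult_left_mono) auto
    then show ?thesis by (simp add: power2_eq_square)
  qed
  also have "\<dots> \<le> ln (1 - 22 / q)"
    using ln_one_minus_pos_lower_bound[of "22 / q"] small q by simp
  finally have "exp (-44 / q) \<le> 1 - 22 / q"
    using small by (subst (asm) ln_ge_iff) auto
  with x have "exp (-44 / q) \<le> x" by simp
  then have "exp (-44 / q) ^ (5 * r) \<le> x ^ (5 * r)"
    by (intro power_mono) auto
  moreover have "exp (-264) \<le> exp (-44 / q) ^ (5 * r)"
  proof -
    have "44 * (5 * real r) \<le> 264 * q" using r q by linarith
    then have "-264 \<le> real (5 * r) * (-44 / q)" using q by (simp add: field_simps)
    then show ?thesis by (simp add: exp_of_nat_mult flip: exp_of_nat_mult)
  qed
  ultimately have pow: "exp (-264) \<le> x ^ (5 * r)" by simp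
  have "2 ^ n / (2 * q) \<le> real (n choose (n div 2))"
    using middle_binomial_ge_sqrt[of n] n q by (simp add: q_def pos_divide_le_eq mult_ac)
  then have "2 ^ n / (2 * q) * exp (-264) \<le> real (n choose (n div 2)) * x ^ (5 * r)"
    using pow q by (intro mult_mono) auto
  also have "\<dots> \<le> real (n choose m)"
    using binomial_below_middle_ge[of n m "5 * r", folded x_def] x small n m(1) by simp
  finally show "exp (-264) / 2 * 2 ^ n / q \<le> real (n choose m)" by (simp add: mult_ac)
qed


section \<open>The lower bound\<close>

lemma lazy_cop_number_hypercube_ge:
  assumes n: "n \<ge> 1000000"
  shows "exp (-264) / 4 * (2 ^ n / sqrt (real n) ^ 7) \<le> real (lazy_cop_number (hypercube n))"
proof (rule ccontr)
  define q where "q = sqrt (real n)"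
  \<comment> \<open>The gap is large enough for superharmonicity, yet \<open>n choose m\<close>
    still has the order 2^n / sqrt n.\<close>
  define m where "m = n div 2 - 5 * nat \<lceil>q\<rceil>"
  define k where "k = lazy_cop_number (hypercube n)"
  define c :: real where "c = exp (-264) / 4"
  assume "\<not> ?thesis"
  then have k: "real k < c * 2 ^ n / q ^ 7" by (simp add: k_def c_def q_def)
  have c: "0 < c" "c \<le> 1/4" by (simp_all add: c_def)
  note bin = binomial_sqrt_below_middle[OF n, folded q_def, folded m_def]
  have q: "q \<ge> 1000"
    unfolding q_def using n by (intro real_le_rsqrt) simp
  have qq: "real n = q\<^sup>2" unfolding q_def by simp
  have n1000: "n \<ge> 1000" using n by simp
  have choose: "2 * c * 2 ^ n / q \<le> real (n choose m)"
    using bin(4) by (simp add: c_def)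
  let ?s = "real n - 2 * real m"
  have s: "?s > 0" using bin(2) q by linarith
  have cube: "1000 * q ^ 3 \<le> ?s ^ 3"
    using power_mono[OF bin(2), of 3] q by (simp add: power_mult_distrib)
  have n4: "real n * (real n - 2) ^ 3 \<le> q ^ 8"
  proof -
    have "real n * (real n - 2) ^ 3 \<le> real n * real n ^ 3"
      using n by (intro mult_left_mono power_mono) auto
    then show ?thesis by (simp add: qq flip: power_mult power_add)
  qed
  have pot_m: "pot n m \<le> q ^ 6 / (2000 * c * 2 ^ n)"
  proof -
    have "pot n m \<le> q ^ 8 / ((1000 * q ^ 3) * (2 * c * 2 ^ n / q))"
      unfolding pot_def using n4 cube choose q c s
      by (intro frac_le mult_mono mult_pos_pos) auto
    also have "\<dots> = q ^ 6 / (2000 * c * 2 ^ n)"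
      using q c by (simp add: field_simps power_numeral_reduce)
    finally show ?thesis .
  qed
  have pot0: "0 \<le> pot n m" using bin(2) n by (intro pot_nonneg gap_less) (auto simp: q_def)
  define f where "f = (\<lambda>d. pot n (max 1 (min d m)))"
  define E where "E = pot n m * (?s + 9/2)"
  note clamp = n1000 bin(1) bin(2)[unfolded q_def]
  \<comment> \<open>The allowance 4/10 is 7/2 - 31/10, what the gain leaves of the decay.\<close>
  have kE: "real k * E \<le> 4/10"
  proof -
    \<comment> \<open>The q^6 of \<open>pot n m\<close> and the q of the gap make up the q^7 that
      the bound on \<open>k\<close> cancels.\<close>
    have "E \<le> q ^ 6 / (2000 * c * 2 ^ n) * (12 * q)"
      unfolding E_def using pot_m pot0 bin(2,3) q c by (intro mult_mono) auto
    then have "real k * E \<le> (c * 2 ^ n / q ^ 7) * (q ^ 6 / (2000 * c * 2 ^ n) * (12 * q))"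
      using k pot0 bin(2) q c by (intro mult_mono) (auto simp: E_def)
    also have "\<dots> = 12 / 2000"
      using q c by (simp add: field_simps power_numeral_reduce)
    finally show ?thesis by simp
  qed
  have start: "real k * (\<Sum>d\<le>n. real (n choose d) * f d) < 2 ^ n"
  proof -
    have "real n * (real n ^ 4 / ?s ^ 3) \<le> q\<^sup>2 * (q ^ 8 / (1000 * q ^ 3))"
      unfolding qq power_mult[symmetric] using cube q qq
      by (intro mult_left_mono frac_le) auto
    also have "\<dots> = q ^ 7 / 1000" using q by (simp add: field_simps power_numeral_reduce)
    finally have 1: "real n * (real n ^ 4 / ?s ^ 3) \<le> q ^ 7 / 1000" .
    have "2 ^ n * pot n m \<le> 2 ^ n * (q ^ 6 / (2000 * c * 2 ^ n))"
      using pot_m by (intro mult_left_mono) auto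
    also have "\<dots> = q ^ 6 / (2000 * c)" using c by (simp add: field_simps)
    also have "\<dots> \<le> q ^ 7 / (2000 * c)"
      using q c by (intro divide_right_mono power_increasing) auto
    finally have 2: "2 ^ n * pot n m \<le> q ^ 7 / (2000 * c)" .
    have 3: "1 \<le> q ^ 7" using q by (intro one_le_power) auto
    have "(\<Sum>d\<le>n. real (n choose d) * f d) \<le> q ^ 7 + q ^ 7 / 1000 + q ^ 7 / (2000 * c)"
      using clamp_sum[OF clamp] 1 2 3 unfolding f_def by linarith
    \<comment> \<open>Factoring out q^7 / c prepares the cancellation against the bound on
      \<open>k\<close>; c <= 1/4 keeps the bracket below 1/2.\<close>
    also have "\<dots> = q ^ 7 / c * (c + c / 1000 + 1 / 2000)" using c by (simp add: field_simps)
    also have "\<dots> \<le> q ^ 7 / c * (1 / 2)" using c q by (intro mult_left_mono) auto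
    finally have "real k * (\<Sum>d\<le>n. real (n choose d) * f d) \<le> (c * 2 ^ n / q ^ 7) * (q ^ 7 / c * (1 / 2))"
      using k clamp_nonneg[OF clamp] q c unfolding f_def
      by (intro mult_mono sum_nonneg mult_nonneg_nonneg) auto
    also have "\<dots> = 2 ^ n / 2" using q c by simp
    also have "\<dots> < 2 ^ n" by simp
    finally show ?thesis .
  qed
  have "\<not> winning_lazy_cop_strategy (hypercube n) k S" for S
  proof (rule hypercube_robber_escapes[where f = f and \<delta> = "7/2" and E = E and g = "31/10"])
    show "real d * f (d - 1) + (real n - real d) * f (d + 1) \<le> (real n - 7/2) * f d + E"
      if "2 \<le> d" for d
      using clamp_decay[OF clamp that] unfolding f_def E_def .
    show "real d * f (d - 1) + (real n - real d) * f (d + 1) \<le> 31/10" if "1 \<le> d" "d \<le> n" for d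
      using clamp_gain[OF clamp that] unfolding f_def .
    show "f d \<ge> 0" for d using clamp_nonneg[OF clamp] unfolding f_def .
    show "f 0 \<ge> 1" "f 1 \<ge> 1"
      using clamp_0[OF clamp] clamp_1[OF clamp] unfolding f_def by simp_all
    show "E \<ge> 0" using pot0 bin(2) q by (simp add: E_def)
    show "31/10 + real k * E \<le> 7/2" using kE by simp
  qed (use n start in auto)
  moreover have "finite (pverts (hypercube n))"
    by (simp add: hypercube_def finite_lists_length_eq[of "UNIV :: bool set" n, simplified])
  ultimately show False
    using lazy_cop_number_attained unfolding k_def by blast
qed

theorem theorem3p1:
  fixes \<epsilon> :: real
  assumes "\<epsilon> > 0"
  shows "(\<lambda>n. real (lazy_cop_number (hypercube n))) \<in> \<Omega>(\<lambda>n. 2 ^ n / real n powr (7 / 2 + \<epsilon>))"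
proof (rule landau_omega.bigI[where c = "exp (-264) / 4"])
  show "\<forall>\<^sub>F n in sequentially. exp (-264) / 4 * norm (2 ^ n / real n powr (7 / 2 + \<epsilon>)) \<le>
      norm (real (lazy_cop_number (hypercube n)))"
    using eventually_ge_at_top[of 1000000]
  proof eventually_elim
    case (elim n)
    then have n: "real n \<ge> 1" by simp
    have "sqrt (real n) ^ 7 = real n powr (7 / 2)"
      using n by (simp add: powr_half_sqrt[symmetric] powr_powr flip: powr_realpow)
    also have "\<dots> \<le> real n powr (7 / 2 + \<epsilon>)"
      using n assms by (intro powr_mono) auto
    finally have "2 ^ n / real n powr (7 / 2 + \<epsilon>) \<le> 2 ^ n / sqrt (real n) ^ 7"
      using n by (intro divide_left_mono) auto
    then have "exp (-264) / 4 * (2 ^ n / real n powr (7 / 2 + \<epsilon>)) \<le> exp (-264) / 4 * (2 ^ n / sqrt (real n) ^ 7)"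
      by (intro mult_left_mono) auto
    also have "\<dots> \<le> real (lazy_cop_number (hypercube n))"
      using elim by (rule lazy_cop_number_hypercube_ge)
    finally show ?case by simp
  qed
qed simp

end
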